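(* Let $n\in\{1,2,\ldots\}$ and let $\mathcal{B}_{1^n}=\{\mu I_n:\mu\in\mathbb{C}\}\subseteq\mathcal{M}_n$. For all $A\in\mathcal{M}_n$, \[ \|A\|_{\mathcal{B}_{1^n}}=\|A\|_{F_n}, \] where $\|A\|_{F_n}=\frac{1}{\sqrt{n}}\sqrt{\mathrm{Tr}(A^*A)}$ is the Frobenius norm normalized with respect to $I_n$.
   Context: $\mathcal{M}_n$ is the C*-algebra of complex $n\times n$ matrices with operator norm $\|\cdot\|_{\mathrm{op}}$ induced by the 2-norm on $\mathbb{C}^n$. For a unital C*-subalgebra $\mathcal{B}\subseteq\mathcal{M}_n$ (containing $I_n$), $P_{\mathcal{B}}:\mathcal{M}_n\to\mathcal{B}$ is the unique conditional expectation onto $\mathcal{B}$ (linear map with $P(B)=B$ for $B\in\mathcal{B}$ and $\|P(A)\|_{\mathrm{op}}\le\|A\|_{\mathrm{op}}$) that preserves $\tau=\frac1n\mathrm{Tr}$, i.e. $\tau\circ P_{\mathcal{B}}=\tau$; equivalently, $P_{\mathcal{B}}$ is the orthogonal projection onto $\mathcal{B}$ for the inner product $\langle A,B\rangle=\tau(B^*A)$. The Frobenius--Rieffel norm is $\|A\|_{\mathcal{B}}=\sqrt{\|P_{\mathcal{B}}(A^*A)\|_{\mathrm{op}}}$. *)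

theory Defs
  imports "HOL-Analysis.Analysis"
begin

text \<open>
  The algebra of complex \<open>n \<times> n\<close> matrices is the type \<open>complex^'n^'n\<close> with \<open>n = CARD('n)\<close>.
  The library norm on this type is the entrywise 2-norm, not the operator norm.
\<close>

definition op_norm :: "complex^'n^'n \<Rightarrow> real" where
  "op_norm A = onorm (\<lambda>x. A *v x)"

text \<open>The library scalar multiplication \<open>*\<^sub>R\<close> on matrices is only over the reals.\<close>

definition cscale :: "complex \<Rightarrow> complex^'n^'n \<Rightarrow> complex^'n^'n" where
  "cscale c A = (\<chi> i j. c * A $ i $ j)"

definition conj_transpose :: "complex^'n^'n \<Rightarrow> complex^'n^'n" where
  "conj_transpose A = (\<chi> i j. cnj (A $ j $ i))"

definition normalized_trace :: "complex^'n^'n \<Rightarrow> complex" where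
  "normalized_trace A = trace A / of_nat CARD('n)"

text \<open>
  Closedness refers to the product topology of \<open>complex^'n^'n\<close>, which is the topology
  of the operator norm since the dimension is finite.
\<close>

definition unital_cstar_subalgebra :: "(complex^'n^'n) set \<Rightarrow> bool" where
  "unital_cstar_subalgebra B \<longleftrightarrow>
     module.subspace cscale B \<and>
     (\<forall>X\<in>B. \<forall>Y\<in>B. X ** Y \<in> B) \<and>
     (\<forall>X\<in>B. conj_transpose X \<in> B) \<and>
     mat 1 \<in> B \<and>
     closed B"

definition conditional_expectation ::
    "(complex^'n^'n) set \<Rightarrow> (complex^'n^'n \<Rightarrow> complex^'n^'n) \<Rightarrow> bool" where
  "conditional_expectation B P \<longleftrightarrow>
     unital_cstar_subalgebra B \<and>
     Vector_Spaces.linear cscale cscale P \<and>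
     range P \<subseteq> B \<and>
     (\<forall>X\<in>B. P X = X) \<and>
     (\<forall>A. op_norm (P A) \<le> op_norm A)"

text \<open>
  For every unital C*-subalgebra \<open>B\<close> the trace-preserving conditional expectation onto
  \<open>B\<close> exists and is unique; for other sets \<open>B\<close> the value is unspecified.
\<close>

definition trace_expectation ::
    "(complex^'n^'n) set \<Rightarrow> complex^'n^'n \<Rightarrow> complex^'n^'n" where
  "trace_expectation B =
     (THE P. conditional_expectation B P \<and>
             (\<forall>A. normalized_trace (P A) = normalized_trace A))"

definition frobenius_rieffel_norm :: "(complex^'n^'n) set \<Rightarrow> complex^'n^'n \<Rightarrow> real" where
  "frobenius_rieffel_norm B A =
     sqrt (op_norm (trace_expectation B (conj_transpose A ** A)))"

definition scalar_subalgebra :: "(complex^'n^'n) set" where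
  "scalar_subalgebra = {cscale \<mu> (mat 1) | \<mu>. True}"

text \<open>\<open>Re\<close> is a coercion only: the trace of \<open>conj_transpose A ** A\<close> is real and nonnegative.\<close>

definition normalized_frobenius_norm :: "complex^'n^'n \<Rightarrow> real" where
  "normalized_frobenius_norm A =
     1 / sqrt (real CARD('n)) * sqrt (Re (trace (conj_transpose A ** A)))"

end

theory Submission imports Defs begin

text \<open>
  The trace-preserving conditional expectation onto the scalar matrices is
  \<open>X \<mapsto> \<tau>(X) I\<close>: trace preservation leaves no other choice, and this map is a contraction
  because every diagonal entry of \<open>X\<close> is bounded by the operator norm of \<open>X\<close>.
  Hence \<open>P(A\<^sup>*A) = \<tau>(A\<^sup>*A) I\<close>, whose operator norm is \<open>\<tau>(A\<^sup>*A)\<close>.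
\<close>

lemma vector_space_cscale: "vector_space (cscale :: complex \<Rightarrow> complex^'n^'n \<Rightarrow> _)"
  by unfold_locales (auto simp: cscale_def vec_eq_iff algebra_simps)

lemma module_cscale: "module (cscale :: complex \<Rightarrow> complex^'n^'n \<Rightarrow> _)"
  by (rule module.intro) (auto simp: cscale_def vec_eq_iff algebra_simps)

lemma bounded_linear_matrix_vector_mult:
  fixes A :: "complex^'n^'m"
  shows "bounded_linear (\<lambda>x. A *v x)"
proof (rule linear_conv_bounded_linear[THEN iffD1], rule linearI)
  show "A *v (x + y) = A *v x + A *v y" for x y
    by (rule matrix_vector_right_distrib)
  show "A *v (r *\<^sub>R x) = r *\<^sub>R (A *v x)" for r x
    by (simp add: matrix_vector_mult_def vec_eq_iff scaleR_sum_right)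
qed

text \<open>The entry is the \<open>i\<close>-th coordinate of the image of the unit vector
  \<open>axis j 1\<close>, and a coordinate never exceeds the 2-norm of its vector.\<close>

lemma norm_entry_le_op_norm:
  fixes A :: "complex^'n^'n"
  shows "norm (A $ i $ j) \<le> op_norm A"
proof -
  have "A $ i $ j = (A *v axis j 1) $ i"
    by (simp add: matrix_vector_mult_def axis_def if_distrib cong: if_cong)
  also have "norm \<dots> \<le> norm (A *v axis j 1)"
    by (rule Finite_Cartesian_Product.norm_nth_le)
  also have "\<dots> \<le> op_norm A * norm (axis j (1::complex))"
    unfolding op_norm_def by (rule onorm[OF bounded_linear_matrix_vector_mult])
  also have "\<dots> = op_norm A"
    by (simp add: norm_eq_sqrt_inner inner_axis_axis)
  finally show ?thesis .
qed

text \<open>An average of diagonal entries is at most the common bound on them. This supplies the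
  contraction property of the expectation.\<close>

lemma norm_normalized_trace_le_op_norm:
  fixes A :: "complex^'n^'n"
  shows "norm (normalized_trace A) \<le> op_norm A"
proof -
  have "norm (trace A) \<le> (\<Sum>i\<in>(UNIV::'n set). op_norm A)"
    unfolding trace_def by (rule sum_norm_le) (rule norm_entry_le_op_norm)
  then show ?thesis
    by (simp add: normalized_trace_def norm_divide field_simps)
qed

lemma op_norm_cscale_mat_1: "op_norm (cscale c (mat 1 :: complex^'n^'n)) = norm c"
proof -
  have eq: "cscale c (mat 1) *v x = c *s x" for x :: "complex^'n"
    by (simp add: cscale_def mat_def matrix_vector_mult_def vec_eq_iff if_distrib
        if_distribR cong: if_cong)
  have "norm (c *s x) = norm c * norm x" for x :: "complex^'n"
    by (simp add: norm_vec_def norm_mult L2_set_right_distrib)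
  then have "op_norm (cscale c (mat 1 :: complex^'n^'n)) \<le> norm c"
    unfolding op_norm_def by (intro onorm_bound) (simp_all add: eq)
  \<comment> \<open>Any diagonal entry equals \<open>c\<close>, so one arbitrary index, here
    \<open>undefined\<close>, gives the lower bound.\<close>
  moreover have "norm c \<le> op_norm (cscale c (mat 1 :: complex^'n^'n))"
    using norm_entry_le_op_norm[of "cscale c (mat 1)" undefined undefined]
    by (simp add: cscale_def mat_def)
  ultimately show ?thesis
    by (rule antisym)
qed

text \<open>Since \<tau>(I) = 1, the map to \<tau>(X) I fixes scalar matrices and preserves \<tau>,
  and a scalar matrix is determined by its trace.\<close>

lemma normalized_trace_cscale_mat_1:
  "normalized_trace (cscale c (mat 1 :: complex^'n^'n)) = c"
  by (simp add: normalized_trace_def trace_def cscale_def mat_def)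

lemma mem_scalar_subalgebra_iff: "X \<in> scalar_subalgebra \<longleftrightarrow> (\<exists>c. X = cscale c (mat 1))"
  by (simp add: scalar_subalgebra_def)

lemma unital_cstar_subalgebra_scalar:
  "unital_cstar_subalgebra (scalar_subalgebra :: (complex^'n^'n) set)"
  unfolding unital_cstar_subalgebra_def
proof (intro conjI ballI)
  let ?B = "scalar_subalgebra :: (complex^'n^'n) set"
  have mem: "cscale c (mat 1) \<in> ?B" for c
    by (auto simp: mem_scalar_subalgebra_iff)
  have zero: "0 \<in> ?B"
    using mem[of 0] by (simp add: module.scale_zero_left[OF module_cscale])
  have add: "X + Y \<in> ?B" if "X \<in> ?B" "Y \<in> ?B" for X Y
    using that unfolding mem_scalar_subalgebra_iff
    by (auto simp: module.scale_left_distrib[OF module_cscale, symmetric])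
  have scale: "cscale c X \<in> ?B" if "X \<in> ?B" for c X
    using that unfolding mem_scalar_subalgebra_iff
    by (auto simp: module.scale_scale[OF module_cscale])
  show "module.subspace cscale ?B"
    using zero add scale by (simp add: module.subspace_def[OF module_cscale])
  show "mat 1 \<in> ?B"
    using mem[of 1] by (simp add: module.scale_one[OF module_cscale])
  show "X ** Y \<in> ?B" if X: "X \<in> ?B" and Y: "Y \<in> ?B" for X Y
  proof -
    obtain a where a: "X = cscale a (mat 1)"
      using X by (auto simp: mem_scalar_subalgebra_iff)
    \<comment> \<open>Left multiplication by a scalar matrix is scaling, so closure under products
      reduces to closure under \<open>cscale\<close>.\<close>
    have "X ** Y = cscale a Y"
      by (simp add: a cscale_def mat_def matrix_matrix_mult_def vec_eq_iff if_distrib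
          if_distribR cong: if_cong)
    then show ?thesis
      using scale Y by simp
  qed
  show "conj_transpose X \<in> ?B" if X: "X \<in> ?B" for X
  proof -
    obtain a where "X = cscale a (mat 1)"
      using X by (auto simp: mem_scalar_subalgebra_iff)
    then have "conj_transpose X = cscale (cnj a) (mat 1)"
      by (auto simp: conj_transpose_def cscale_def mat_def vec_eq_iff)
    then show ?thesis
      using mem by simp
  qed
  \<comment> \<open>Real scaling is a special case of complex scaling, so the set is also a real
    subspace; in finite dimension every such subspace is closed.\<close>
  have "r *\<^sub>R X = cscale (of_real r) X" for r and X :: "complex^'n^'n"
    by (simp add: cscale_def vec_eq_iff scaleR_conv_of_real[where 'a=complex])
  then have "subspace ?B"
    using zero add scale by (simp add: subspace_def)
  then show "closed ?B"
    by (rule closed_subspace)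
qed

lemma conditional_expectation_scalar:
  "conditional_expectation scalar_subalgebra
     (\<lambda>X :: complex^'n^'n. cscale (normalized_trace X) (mat 1))"
  unfolding conditional_expectation_def
proof (intro conjI allI ballI)
  have "normalized_trace (X + Y) = normalized_trace X + normalized_trace Y"
    for X Y :: "complex^'n^'n"
    by (simp add: normalized_trace_def trace_add add_divide_distrib)
  moreover have "normalized_trace (cscale c X) = c * normalized_trace X"
    for c and X :: "complex^'n^'n"
    by (simp add: normalized_trace_def trace_def cscale_def sum_distrib_left)
  ultimately show "Vector_Spaces.linear cscale cscale
      (\<lambda>X :: complex^'n^'n. cscale (normalized_trace X) (mat 1))"
    by (intro Vector_Spaces.linear.intro module_hom.intro module_hom_axioms.intro
        vector_space_cscale module_cscale)
      (simp_all add: module.scale_left_distrib[OF module_cscale]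
        module.scale_scale[OF module_cscale])
qed (auto intro: unital_cstar_subalgebra_scalar norm_normalized_trace_le_op_norm
  simp: op_norm_cscale_mat_1 normalized_trace_cscale_mat_1 mem_scalar_subalgebra_iff)

text \<open>The description by \<open>THE\<close> needs existence, shown above, and uniqueness: a
  value of \<open>P\<close> is some \<open>cscale c (mat 1)\<close>, and trace preservation forces
  \<open>c\<close> to be \<tau>(X).\<close>

lemma trace_expectation_scalar:
  "trace_expectation scalar_subalgebra =
     (\<lambda>X :: complex^'n^'n. cscale (normalized_trace X) (mat 1))"
  unfolding trace_expectation_def
proof (rule the_equality)
  fix P :: "complex^'n^'n \<Rightarrow> complex^'n^'n"
  assume P: "conditional_expectation scalar_subalgebra P \<and>
    (\<forall>A. normalized_trace (P A) = normalized_trace A)"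
  show "P = (\<lambda>X. cscale (normalized_trace X) (mat 1))"
  proof
    fix X
    have "P X \<in> scalar_subalgebra"
      using P by (auto simp: conditional_expectation_def)
    then obtain c where c: "P X = cscale c (mat 1)"
      by (auto simp: mem_scalar_subalgebra_iff)
    have "normalized_trace X = normalized_trace (P X)"
      using P by simp
    also have "\<dots> = c"
      by (simp add: c normalized_trace_cscale_mat_1)
    finally show "P X = cscale (normalized_trace X) (mat 1)"
      by (simp add: c)
  qed
qed (simp add: conditional_expectation_scalar normalized_trace_cscale_mat_1)

text \<open>The \<open>i\<close>-th diagonal entry of the product is the squared 2-norm of column
  \<open>i\<close> of \<open>A\<close>.\<close>

lemma trace_conj_transpose_mult:
  fixes A :: "complex^'n^'n"
  shows "trace (conj_transpose A ** A) = of_real (\<Sum>i\<in>UNIV. \<Sum>j\<in>UNIV. (norm (A $ j $ i))\<^sup>2)"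
  by (simp only: trace_def conj_transpose_def matrix_matrix_mult_def vec_lambda_beta
      of_real_sum complex_norm_square mult.commute)

theorem theorem3p16:
  fixes A :: "complex^'n^'n"
  shows "frobenius_rieffel_norm scalar_subalgebra A = normalized_frobenius_norm A"
proof -
  define s where "s = (\<Sum>i\<in>UNIV. \<Sum>j\<in>UNIV. (norm (A $ j $ i))\<^sup>2)"
  have "s \<ge> 0"
    unfolding s_def by (intro sum_nonneg) simp
  moreover have "trace (conj_transpose A ** A) = of_real s"
    unfolding s_def by (rule trace_conj_transpose_mult)
  \<comment> \<open>With n = \<open>CARD('n)\<close>, the left side is the square root of
    \<open>norm (of_real s / n)\<close>. As s \<ge> 0, this norm is s/n, and both sides equal
    \<open>sqrt (s / n)\<close>.\<close>
  ultimately show ?thesis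
    by (simp add: frobenius_rieffel_norm_def normalized_frobenius_norm_def
        trace_expectation_scalar op_norm_cscale_mat_1 normalized_trace_def
        norm_divide real_sqrt_divide)
qed

end
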